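(* Let $p\neq2$ be a prime and let $H_p$ be the Heisenberg group modulo $p$, i.e. the group of upper unitriangular matrices $M(a,b,c)=\begin{pmatrix}1&a&b\\0&1&c\\0&0&1\end{pmatrix}$ with $a,b,c\in\mathbb{Z}/p\mathbb{Z}$. Let $\eta$ be a primitive $p$-th root of unity in $\mathbb{C}$. For $i,j\in\{0,1,\dots,p-1\}$ let $\chi_{i,j}$ be the one-dimensional character of $H_p$ whose value at $M(a,b,c)$ is $\eta^{ai+cj}$; for $s\in\{1,\dots,p-1\}$ let $\tau_s$ be the irreducible character of $H_p$ of degree $p$ whose value at $M(a,b,c)$ is $p\,\eta^{sb}$ if $a=c=0$ and $0$ otherwise. Let $s\in\{1,\dots,p-1\}$ and let $n\ge0$ be an integer; when $p\nmid n$ let $n'\in\{1,\dots,p-1\}$ be determined by $ns\equiv n'\pmod p$. Then $$\lambda^n(\tau_s)=\begin{cases}\chi_{0,0}&(n=0,p),\\[2pt] \dfrac1p\dbinom{p}{n}\tau_{n'}&(n=1,\dots,p-1),\\[2pt] 0&(n>p),\end{cases}$$ $$S^n(\tau_s)=\begin{cases}\dfrac{1}{p^2}\Bigl(\dbinom{p+n-1}{n}+(p^2-1)\Bigr)\chi_{0,0}+\displaystyle\sum_{\substack{0\le i,j\le p-1\\(i,j)\ne(0,0)}}\dfrac1{p^2}\Bigl(\dbinom{p+n-1}{n}-1\Bigr)\chi_{i,j}&(p\mid n),\\[2pt] \dfrac1p\dbinom{p+n-1}{n}\tau_{n'}&(p\nmid n).\end{cases}$$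
   Context: For a finite group $G$, $\mathrm{Map}(G,\mathbb{C})$ is the commutative $\mathbb{C}$-algebra of all functions $G\to\mathbb{C}$ with pointwise operations. Adams operations: $\psi^n(f)(g)=f(g^n)$ for $n\ge1$. The $\lambda$-operations $\lambda^i$ ($i\ge 0$) on $\mathrm{Map}(G,\mathbb{C})$ are defined by letting $\lambda_t(f)=\sum_{i\ge0}\lambda^i(f)t^i$ be the unique formal power series over $\mathrm{Map}(G,\mathbb{C})$ with constant term $1$ satisfying $\sum_{n\ge1}\psi^n(f)(-t)^n=-t\,\bigl(\tfrac{d}{dt}\lambda_t(f)\bigr)\lambda_t(f)^{-1}$. The symmetric power operations $S^i$ are defined by $S_t(f)=\sum_{i\ge0}S^i(f)t^i=(\lambda_{-t}(f))^{-1}$. (If $\chi$ is the character of a finite-dimensional complex representation $V$, then $\lambda^i(\chi)$ and $S^i(\chi)$ are the characters of $\bigwedge^i V$ and $S^i(V)$.) *)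

theory Defs
  imports
    "HOL-Analysis.Analysis"
    "HOL-Library.Function_Algebras"
    "HOL-Computational_Algebra.Formal_Power_Series"
    "Berlekamp_Zassenhaus.Finite_Field"
begin

section \<open>Operations on the algebra of functions on a finite group\<close>

class finite_group = finite + monoid_mult +
  assumes ex_left_inverse: "\<exists>y. y * x = 1"

text \<open>
  For \<open>'g :: finite_group\<close> the algebra \<open>Map(G, C)\<close> is the type \<open>'g \<Rightarrow> complex\<close>; its pointwise
  commutative ring structure is the one of \<open>HOL-Library.Function_Algebras\<close>, and formal power
  series over it form the type \<open>('g \<Rightarrow> complex) fps\<close>.  Only the scalar multiplication has to be added.
\<close>

definition cscale :: "complex \<Rightarrow> ('g \<Rightarrow> complex) \<Rightarrow> 'g \<Rightarrow> complex"  (infixr "*\<^sub>C" 75) where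
  "c *\<^sub>C f = (\<lambda>g. c * f g)"

definition adams :: "nat \<Rightarrow> ('g::finite_group \<Rightarrow> complex) \<Rightarrow> 'g \<Rightarrow> complex" where
  "adams n f = (\<lambda>g. f (g ^ n))"

text \<open>
  The library operation \<open>inverse\<close> on power series is tied to coefficients with an \<open>inverse\<close>
  operation.  For a series with constant term \<open>1\<close> over a commutative ring, its inverse
  is \<open>fps_right_inverse F 1\<close>.
\<close>

abbreviation fps_inv1 :: "'a::comm_ring_1 fps \<Rightarrow> 'a fps" where
  "fps_inv1 F \<equiv> fps_right_inverse F 1"

lemma fps_inv1:
  fixes F :: "'a::comm_ring_1 fps"
  assumes "fps_nth F 0 = 1"
  shows "F * fps_inv1 F = 1"
  using fps_right_inverse[of F 1] assms by simp

definition is_lambda_series ::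
    "('g::finite_group \<Rightarrow> complex) \<Rightarrow> ('g \<Rightarrow> complex) fps \<Rightarrow> bool" where
  "is_lambda_series f L \<longleftrightarrow> fps_nth L 0 = 1 \<and>
     Abs_fps (\<lambda>n. if n = 0 then 0 else (- 1) ^ n * adams n f)
       = - fps_X * fps_deriv L * fps_inv1 L"

definition lambda_series :: "('g::finite_group \<Rightarrow> complex) \<Rightarrow> ('g \<Rightarrow> complex) fps" where
  "lambda_series f = (THE L. is_lambda_series f L)"

definition lambda_op :: "nat \<Rightarrow> ('g::finite_group \<Rightarrow> complex) \<Rightarrow> 'g \<Rightarrow> complex" where
  "lambda_op i f = fps_nth (lambda_series f) i"

definition sym_series :: "('g::finite_group \<Rightarrow> complex) \<Rightarrow> ('g \<Rightarrow> complex) fps" where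
  "sym_series f = fps_inv1 (fps_compose (lambda_series f) (- fps_X))"

definition sym_op :: "nat \<Rightarrow> ('g::finite_group \<Rightarrow> complex) \<Rightarrow> 'g \<Rightarrow> complex" where
  "sym_op i f = fps_nth (sym_series f) i"

text \<open>Existence and uniqueness of the series, so that \<^const>\<open>lambda_series\<close> is well defined.\<close>

lemma fps_X_deriv_nth:
  "fps_nth (fps_X * fps_deriv L) n = of_nat n * fps_nth (L :: 'a::comm_ring_1 fps) n"
  by (cases n) simp_all

lemma is_lambda_series_iff:
  fixes f :: "'g::finite_group \<Rightarrow> complex"
  shows "is_lambda_series f L \<longleftrightarrow> fps_nth L 0 = 1 \<and>
    (\<forall>n g. of_nat n * fps_nth L n g
        = - (\<Sum>k=1..n. (- 1) ^ k * f (g ^ k) * fps_nth L (n - k) g))"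
proof (cases "fps_nth L 0 = 1")
  case True
  define A where "A = Abs_fps (\<lambda>n. if n = 0 then 0 else (- 1) ^ n * adams n f)"
  have inv: "L * fps_inv1 L = 1" using True by (rule fps_inv1)
  have "A = - fps_X * fps_deriv L * fps_inv1 L \<longleftrightarrow> fps_X * fps_deriv L = - (A * L)"
  proof
    assume "A = - fps_X * fps_deriv L * fps_inv1 L"
    hence "A * L = - (fps_X * fps_deriv L) * (L * fps_inv1 L)"
      by (simp add: mult.assoc mult.commute mult.left_commute)
    thus "fps_X * fps_deriv L = - (A * L)" by (simp add: inv)
  next
    assume "fps_X * fps_deriv L = - (A * L)"
    hence "- fps_X * fps_deriv L * fps_inv1 L = A * (L * fps_inv1 L)"
      by (simp add: mult.assoc)
    thus "A = - fps_X * fps_deriv L * fps_inv1 L" by (simp add: inv)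
  qed
  also have "\<dots> \<longleftrightarrow> (\<forall>n. of_nat n * fps_nth L n = - fps_nth (A * L) n)"
    unfolding fps_eq_iff fps_X_deriv_nth by simp
  also have "\<dots> \<longleftrightarrow> (\<forall>n g. of_nat n * fps_nth L n g
        = - (\<Sum>k=1..n. (- 1) ^ k * f (g ^ k) * fps_nth L (n - k) g))"
  proof -
    have pow: "((- 1) ^ k :: 'g \<Rightarrow> complex) g = (- 1) ^ k" for k g
      by (induction k) simp_all
    have sumf: "(\<Sum>k\<in>S. F k) g = (\<Sum>k\<in>S. F k g)" for S g and F :: "nat \<Rightarrow> 'g \<Rightarrow> complex"
      by (induction S rule: infinite_finite_induct) simp_all
    have "fps_nth (A * L) n g = (\<Sum>k=1..n. (- 1) ^ k * f (g ^ k) * fps_nth L (n - k) g)" for n g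
      unfolding fps_mult_nth sumf
      by (subst sum.atLeast_Suc_atMost) (auto simp: A_def pow adams_def intro!: sum.cong)
    thus ?thesis by (simp add: fun_eq_iff of_nat_fun)
  qed
  finally show ?thesis by (simp add: is_lambda_series_def A_def True)
qed (simp add: is_lambda_series_def)

fun lambda_coeff :: "('g::finite_group \<Rightarrow> complex) \<Rightarrow> nat \<Rightarrow> 'g \<Rightarrow> complex" where
  "lambda_coeff f n g = (if n = 0 then 1 else
     - (\<Sum>k\<in>{1..n}. (- 1) ^ k * f (g ^ k) * lambda_coeff f (n - k) g) / of_nat n)"

declare lambda_coeff.simps [simp del]

lemma ex1_lambda_series: "\<exists>!L. is_lambda_series f L"
proof (rule ex1I)
  show "is_lambda_series f (Abs_fps (lambda_coeff f))"
    unfolding is_lambda_series_iff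
  proof (intro conjI allI)
    show "fps_nth (Abs_fps (lambda_coeff f)) 0 = 1"
      by (simp add: fun_eq_iff lambda_coeff.simps)
    fix n g
    show "of_nat n * fps_nth (Abs_fps (lambda_coeff f)) n g
        = - (\<Sum>k=1..n. (- 1) ^ k * f (g ^ k) * fps_nth (Abs_fps (lambda_coeff f)) (n - k) g)"
      by (cases "n = 0") (simp_all add: lambda_coeff.simps[of f n])
  qed
next
  fix L assume L: "is_lambda_series f L"
  have "fps_nth L n g = lambda_coeff f n g" for n g
  proof (induction n rule: less_induct)
    case (less n)
    show ?case
    proof (cases "n = 0")
      case True
      thus ?thesis using L by (simp add: is_lambda_series_iff lambda_coeff.simps)
    next
      case False
      have "of_nat n * fps_nth L n g
          = - (\<Sum>k=1..n. (- 1) ^ k * f (g ^ k) * fps_nth L (n - k) g)"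
        using L by (simp add: is_lambda_series_iff)
      also have "\<dots> = - (\<Sum>k=1..n. (- 1) ^ k * f (g ^ k) * lambda_coeff f (n - k) g)"
        by (intro arg_cong[of _ _ uminus] sum.cong) (auto simp: less.IH)
      finally show ?thesis
        using False by (simp add: lambda_coeff.simps[of f n] field_simps)
    qed
  qed
  thus "L = Abs_fps (lambda_coeff f)" by (simp add: fps_eq_iff fun_eq_iff)
qed


section \<open>The Heisenberg group modulo \<open>p\<close>\<close>

text \<open>
  \<open>Z/pZ\<close> is \<open>'p mod_ring\<close>, where \<open>p = CARD('p)\<close>.  The sort \<open>nontriv\<close> only says that \<open>p > 1\<close>.
\<close>

definition unitri :: "'p mod_ring \<Rightarrow> 'p mod_ring \<Rightarrow> 'p mod_ring \<Rightarrow> ('p::nontriv) mod_ring ^ 3 ^ 3" where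
  "unitri a b c = vector [vector [1, a, b],
                          vector [0, 1, c],
                          vector [0, 0, 1]]"

lemma unitri_nth [simp]:
  "unitri a b c $ 1 $ 1 = 1" "unitri a b c $ 1 $ 2 = a" "unitri a b c $ 1 $ 3 = b"
  "unitri a b c $ 2 $ 1 = 0" "unitri a b c $ 2 $ 2 = 1" "unitri a b c $ 2 $ 3 = c"
  "unitri a b c $ 3 $ 1 = 0" "unitri a b c $ 3 $ 2 = 0" "unitri a b c $ 3 $ 3 = 1"
  by (simp_all add: unitri_def)

lemma unitri_eq_iff [simp]: "unitri a b c = unitri a' b' c' \<longleftrightarrow> a = a' \<and> b = b' \<and> c = c'"
  by (metis unitri_nth)

lemma unitri_mult: "unitri a b c ** unitri a' b' c' = unitri (a + a') (b + b' + a * c') (c + c')"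
  by (simp add: vec_eq_iff forall_3 matrix_matrix_mult_def sum_3 algebra_simps)

lemma unitri_one: "mat 1 = unitri 0 0 0"
  by (simp add: vec_eq_iff forall_3 mat_def)

typedef (overloaded) ('p::nontriv) heisenberg = "{unitri a b c | a b c :: 'p mod_ring. True}"
  by auto

definition M :: "'p mod_ring \<Rightarrow> 'p mod_ring \<Rightarrow> 'p mod_ring \<Rightarrow> ('p::nontriv) heisenberg" where
  "M a b c = Abs_heisenberg (unitri a b c)"

lemma Rep_M [simp]: "Rep_heisenberg (M a b c) = unitri a b c"
  unfolding M_def by (rule Abs_heisenberg_inverse) auto

lemma M_eq_iff [simp]: "M a b c = M a' b' c' \<longleftrightarrow> a = a' \<and> b = b' \<and> c = c'"
  by (metis Rep_M unitri_eq_iff)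

lemma heisenberg_cases [cases type: heisenberg]: obtains a b c where "x = M a b c"
proof -
  obtain a b c where "Rep_heisenberg x = unitri a b c"
    using Rep_heisenberg[of x] by auto
  hence "x = M a b c" by (metis M_def Rep_heisenberg_inverse)
  thus ?thesis by (rule that)
qed

instantiation heisenberg :: (nontriv) "{one, times}"
begin

definition one_heisenberg :: "'a heisenberg" where
  "1 = Abs_heisenberg (mat 1)"

definition times_heisenberg :: "'a heisenberg \<Rightarrow> 'a heisenberg \<Rightarrow> 'a heisenberg" where
  "x * y = Abs_heisenberg (Rep_heisenberg x ** Rep_heisenberg y)"

instance ..

end

lemma one_M: "1 = M 0 0 0"
  by (simp add: one_heisenberg_def unitri_one M_def)

lemma times_M: "M a b c * M a' b' c' = M (a + a') (b + b' + a * c') (c + c')"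
  by (simp add: times_heisenberg_def unitri_mult M_def[symmetric])

instance heisenberg :: (nontriv) finite_group
proof
  have "UNIV = (\<lambda>(a, b, c). M a b c) ` (UNIV :: ('a mod_ring \<times> 'a mod_ring \<times> 'a mod_ring) set)"
    by (auto simp: image_iff) (metis heisenberg_cases)
  thus "finite (UNIV :: 'a heisenberg set)" by (metis finite finite_imageI)
next
  fix x y z :: "'a heisenberg"
  show "x * y * z = x * (y * z)"
    by (cases x; cases y; cases z) (simp add: times_M algebra_simps)
  show "1 * x = x" "x * 1 = x"
    by (cases x; simp add: one_M times_M)+
  show "\<exists>y. y * x = 1"
  proof (cases x)
    case (1 a b c)
    have "M (- a) (a * c - b) (- c) * x = 1"
      by (simp add: 1 times_M one_M)
    thus ?thesis ..
  qed
qed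


section \<open>Characters of the Heisenberg group\<close>

definition primitive_root_of_unity :: "nat \<Rightarrow> complex \<Rightarrow> bool" where
  "primitive_root_of_unity k z \<longleftrightarrow> k > 0 \<and> z ^ k = 1 \<and> (\<forall>m. 0 < m \<and> m < k \<longrightarrow> z ^ m \<noteq> 1)"

text \<open>
  Exponents in \<open>Z/pZ\<close> of a \<open>p\<close>-th root of unity are evaluated at the representative in
  \<open>{0..<p}\<close> given by \<^const>\<open>to_int_mod_ring\<close>.
\<close>

definition chi :: "complex \<Rightarrow> nat \<Rightarrow> nat \<Rightarrow> ('p::nontriv) heisenberg \<Rightarrow> complex" where
  "chi \<eta> i j g = (let a = Rep_heisenberg g $ 1 $ 2; c = Rep_heisenberg g $ 2 $ 3
     in \<eta> powi (to_int_mod_ring a * int i + to_int_mod_ring c * int j))"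

definition tau :: "complex \<Rightarrow> nat \<Rightarrow> ('p::nontriv) heisenberg \<Rightarrow> complex" where
  "tau \<eta> s g = (let a = Rep_heisenberg g $ 1 $ 2; b = Rep_heisenberg g $ 1 $ 3;
                    c = Rep_heisenberg g $ 2 $ 3
     in if a = 0 \<and> c = 0 then of_nat CARD('p) * \<eta> powi (int s * to_int_mod_ring b) else 0)"

lemma chi_M: "chi \<eta> i j (M a b c) = \<eta> powi (to_int_mod_ring a * int i + to_int_mod_ring c * int j)"
  by (simp add: chi_def)

lemma tau_M: "tau \<eta> s (M a b c :: 'p::nontriv heisenberg) =
    (if a = 0 \<and> c = 0 then of_nat CARD('p) * \<eta> powi (int s * to_int_mod_ring b) else 0)"
  by (simp add: tau_def)

end

theory Submission
  imports Defs
begin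

text \<open>
  The defining equation of \<open>\<lambda>\<^sub>t(f)\<close> holds pointwise on the group, and at a point \<open>g\<close> it only involves
  the values \<open>f(g\<^sup>n)\<close>. At a central element \<open>M 0 b 0\<close> these are \<open>p \<omega>\<^sup>n\<close> with
  \<open>\<omega> = \<eta>\<^sup>s\<^sup>b\<close>, so \<open>\<lambda>\<^sub>t = (1 + \<omega> t)\<^sup>p\<close>. Any other element has order \<open>p\<close> (as \<open>p\<close> is odd) and
  its powers are central only when they are trivial, so that \<open>\<lambda>\<^sub>t = 1 + t\<^sup>p\<close>. The formulas for the
  symmetric powers follow by inverting these two series; the sum of the \<open>\<chi>\<^sub>i\<^sub>j\<close> is \<open>p\<^sup>2\<close> times the
  indicator of the centre.
\<close>

section \<open>Evaluation of the operations at a single group element\<close>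

lemma lambda_op_eqI:
  fixes f :: "'g::finite_group \<Rightarrow> complex"
  assumes "fps_nth A 0 = 1"
    and "fps_X * fps_deriv A = - (Abs_fps (\<lambda>k. if k = 0 then 0 else (- 1) ^ k * f (g ^ k)) * A)"
  shows "lambda_op n f g = fps_nth A n"
proof (induction n rule: less_induct)
  case (less n)
  have L: "is_lambda_series f (lambda_series f)"
    unfolding lambda_series_def by (rule theI'[OF ex1_lambda_series])
  show ?case
  proof (cases "n = 0")
    case True
    thus ?thesis using L assms(1) by (simp add: is_lambda_series_iff lambda_op_def)
  next
    case False
    \<comment> \<open>The coefficient of \<open>t^n\<close> in the defining equation is a recursion
      that stays at the point \<open>g\<close>. It determines the next coefficient because
      \<open>n\<close> is nonzero in the complex numbers.\<close>
    have "of_nat n * lambda_op n f g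
        = - (\<Sum>k=1..n. (- 1) ^ k * f (g ^ k) * lambda_op (n - k) f g)"
      using L by (simp add: is_lambda_series_iff lambda_op_def)
    also have "\<dots> = - (\<Sum>k=1..n. (- 1) ^ k * f (g ^ k) * fps_nth A (n - k))"
      by (intro arg_cong[of _ _ uminus] sum.cong) (auto simp: less.IH)
    \<comment> \<open>The convolution runs from 0, but its term at 0 vanishes because the Adams
      series has constant term 0.\<close>
    also have "\<dots> = fps_nth (fps_X * fps_deriv A) n"
      unfolding assms(2) fps_neg_nth fps_mult_nth
      by (subst (2) sum.atLeast_Suc_atMost) (auto intro!: sum.cong)
    also have "\<dots> = of_nat n * fps_nth A n" by (rule fps_X_deriv_nth)
    finally show ?thesis using False by simp
  qed
qed

text \<open>Evaluation at \<open>g\<close> is a ring homomorphism to the complex numbers, so the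
  series can be evaluated first and then inverted over a field. The signs come from substituting
  \<open>-t\<close>.\<close>

lemma sym_op_eq:
  fixes f :: "'g::finite_group \<Rightarrow> complex"
  shows "sym_op n f g = fps_nth (inverse (Abs_fps (\<lambda>i. (- 1) ^ i * lambda_op i f g))) n"
proof -
  define F where "F = fps_compose (lambda_series f) (- fps_X)"
  have L0: "fps_nth (lambda_series f) 0 = 1"
    using theI'[OF ex1_lambda_series, of f]
    by (simp add: is_lambda_series_def lambda_series_def)
  have F_nth: "fps_nth F i g = (- 1) ^ i * lambda_op i f g" for i
  proof -
    have "((- 1) ^ i :: 'g \<Rightarrow> complex) g = (- 1) ^ i"
      by (induction i) simp_all
    thus ?thesis by (simp add: F_def fps_compose_uminus' lambda_op_def)
  qed
  have "fps_nth F 0 = 1" by (simp add: F_def L0)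
  hence inv: "F * fps_inv1 F = 1" by (rule fps_inv1)
  have "Abs_fps (\<lambda>i. fps_nth F i g) * Abs_fps (\<lambda>i. fps_nth (fps_inv1 F) i g) = 1"
  proof (rule fps_ext)
    fix m
    have sumf: "(\<Sum>k\<in>S. h k) g = (\<Sum>k\<in>S. h k g)" for S and h :: "nat \<Rightarrow> 'g \<Rightarrow> complex"
      by (induction S rule: infinite_finite_induct) simp_all
    have "fps_nth (F * fps_inv1 F) m g = fps_nth 1 m"
      unfolding inv by simp
    thus "fps_nth (Abs_fps (\<lambda>i. fps_nth F i g) * Abs_fps (\<lambda>i. fps_nth (fps_inv1 F) i g)) m
        = fps_nth 1 m"
      by (simp only: fps_mult_nth sumf times_fun_def fps_nth_Abs_fps)
  qed
  hence "Abs_fps (\<lambda>i. fps_nth (fps_inv1 F) i g) = inverse (Abs_fps (\<lambda>i. fps_nth F i g))"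
    by (metis fps_inverse_unique)
  thus ?thesis
    by (simp add: fps_eq_iff F_nth sym_op_def sym_series_def F_def[symmetric])
qed

text \<open>This serves the central elements. The sum of \<open>p (-w t)^k\<close> over
  \<open>k \<ge> 1\<close> is \<open>- p w t / (1 + w t)\<close>, which is minus \<open>t\<close>
  times the logarithmic derivative of \<open>(1 + w t)^p\<close>.\<close>

lemma
  fixes f :: "'g::finite_group \<Rightarrow> complex"
  assumes "p > 0" and f: "\<And>k. k > 0 \<Longrightarrow> f (g ^ k) = of_nat p * w ^ k"
  shows lambda_op_scalar: "lambda_op n f g = of_nat (p choose n) * w ^ n"
    and sym_op_scalar: "sym_op n f g = of_nat ((p + n - 1) choose n) * w ^ n"
proof -
  define A where "A = (1 - fps_const (- w) * fps_X) ^ p"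
  define P where "P = Abs_fps (\<lambda>k. if k = 0 then 0 else (- 1) ^ k * f (g ^ k))"
  have A_nth: "fps_nth A m = of_nat (p choose m) * w ^ m" for m
  proof (cases "w = 0")
    case True
    thus ?thesis by (cases m) (simp_all add: A_def)
  next
    case False
    thus ?thesis
      unfolding A_def by (subst one_minus_const_fps_X_power)
        (simp_all add: binomial_gbinomial)
  qed
  \<comment> \<open>The geometric series is summed by clearing its denominator: consecutive
    coefficients cancel, and only the one at \<open>t\<close> survives.\<close>
  have P: "P * (1 + fps_const w * fps_X) = - (fps_const (of_nat p * w) * fps_X)"
  proof (rule fps_ext)
    fix m
    have "P * (1 + fps_const w * fps_X) = P + fps_const w * (fps_X * P)"
      by (simp add: algebra_simps)
    moreover have "fps_nth (P + fps_const w * (fps_X * P)) m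
        = fps_nth (- (fps_const (of_nat p * w) * fps_X)) m"
    proof (cases m)
      case (Suc k)
      show ?thesis
      proof (cases "k = 0")
        case True
        thus ?thesis using f[of 1] by (simp add: Suc P_def)
      next
        case False
        thus ?thesis using f[of "Suc k"] f[of k] by (simp add: Suc P_def)
      qed
    qed (simp add: P_def)
    ultimately show "fps_nth (P * (1 + fps_const w * fps_X)) m
        = fps_nth (- (fps_const (of_nat p * w) * fps_X)) m" by simp
  qed
  have "fps_deriv A = fps_const (of_nat p * w) * (1 + fps_const w * fps_X) ^ (p - 1)"
    by (simp add: A_def fps_deriv_power flip: fps_const_neg)
  hence "fps_deriv A * (1 + fps_const w * fps_X)
      = fps_const (of_nat p * w) * ((1 + fps_const w * fps_X) ^ (p - 1) * (1 + fps_const w * fps_X))"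
    by (simp only: mult.assoc)
  also have "(1 + fps_const w * fps_X) ^ (p - 1) * (1 + fps_const w * fps_X) = A"
    unfolding power_minus_mult[OF assms(1)] by (simp add: A_def flip: fps_const_neg)
  finally have "fps_deriv A * (1 + fps_const w * fps_X) = fps_const (of_nat p * w) * A" .
  hence "fps_X * fps_deriv A * (1 + fps_const w * fps_X)
      = - (P * (1 + fps_const w * fps_X)) * A"
    unfolding P by (simp add: mult_ac)
  hence "(fps_X * fps_deriv A) * (1 + fps_const w * fps_X)
      = - (P * A) * (1 + fps_const w * fps_X)"
    by (simp add: mult_ac)
  \<comment> \<open>Power series over a field form an integral domain, so this factor can be
    cancelled.\<close>
  moreover have "1 + fps_const w * fps_X \<noteq> 0"
    by (metis fps_nonzeroI fps_add_nth fps_mult_fps_X_commute fps_mult_left_const_nth fps_X_nth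
        fps_one_nth add.right_neutral mult_zero_right zero_neq_one)
  ultimately have "fps_X * fps_deriv A = - (P * A)" by (metis mult_right_cancel)
  hence lam: "lambda_op m f g = of_nat (p choose m) * w ^ m" for m
    using lambda_op_eqI[of A f g m] by (simp add: P_def A_nth)
  show "lambda_op n f g = of_nat (p choose n) * w ^ n" by (rule lam)
  have "Abs_fps (\<lambda>i. (- 1) ^ i * lambda_op i f g) = (1 - fps_const w * fps_X) ^ p"
  proof (cases "w = 0")
    case True
    thus ?thesis by (auto simp: lam fps_eq_iff power_0_left)
  next
    case False
    have "(- 1) ^ i * (c * w ^ i) = (- w) ^ i * c" for i and c :: complex
      by (simp add: power_minus[of w])
    thus ?thesis
      by (subst one_minus_const_fps_X_power)
        (use False in \<open>simp_all add: lam fps_eq_iff binomial_gbinomial\<close>)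
  qed
  thus "sym_op n f g = of_nat ((p + n - 1) choose n) * w ^ n"
    using assms(1) by (simp add: sym_op_eq one_minus_const_fps_X_neg_power')
qed

text \<open>This serves the noncentral elements. The values are those of the regular character of a
  cyclic group of order \<open>p\<close> along the powers of a generator, so \<open>A\<close> is the
  product of \<open>1 + z t\<close> over all \<open>p\<close>-th roots of unity \<open>z\<close>,
  which is \<open>1 + t^p\<close> for odd \<open>p\<close>.\<close>

lemma
  fixes f :: "'g::finite_group \<Rightarrow> complex"
  assumes "odd p" and f: "\<And>k. k > 0 \<Longrightarrow> f (g ^ k) = (if p dvd k then of_nat p else 0)"
  shows lambda_op_regular: "lambda_op n f g = (if n = 0 \<or> n = p then 1 else 0)"
    and sym_op_regular: "sym_op n f g = (if p dvd n then 1 else 0)"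
proof -
  define A :: "complex fps" where "A = 1 + fps_X ^ p"
  define P where "P = Abs_fps (\<lambda>k. if k = 0 then 0 else (- 1) ^ k * f (g ^ k))"
  have p: "p > 0" using \<open>odd p\<close> by (rule odd_pos)
  have P: "P * A = - (of_nat p * fps_X ^ p)"
  proof (rule fps_ext)
    fix m
    \<comment> \<open>A shift by the odd number \<open>p\<close> flips the sign, so coefficients
      \<open>m\<close> and \<open>m - p\<close> of \<open>P\<close> cancel for \<open>m > p\<close>.
      At \<open>m = p\<close> the shifted one is the zero constant term, which leaves
      \<open>-p\<close>.\<close>
    have *: "(- 1 :: complex) ^ m = - ((- 1) ^ (m - p))" if "p \<le> m"
      using that \<open>odd p\<close> by (metis le_add_diff_inverse mult_minus1 power_add power_minus_odd power_one)
    show "fps_nth (P * A) m = fps_nth (- (of_nat p * fps_X ^ p)) m"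
    proof (cases m p rule: linorder_cases)
      case less
      thus ?thesis using p by (auto simp: A_def distrib_left P_def f fps_X_power_mult_right_nth
        fps_mult_of_nat_nth dest: dvd_imp_le)
    next
      case equal
      thus ?thesis using p \<open>odd p\<close>
        by (simp add: A_def distrib_left P_def f fps_X_power_mult_right_nth fps_mult_of_nat_nth)
    next
      case greater
      thus ?thesis using p
        by (simp add: A_def distrib_left P_def f fps_X_power_mult_right_nth fps_mult_of_nat_nth *
          dvd_minus_self)
    qed
  qed
  have "fps_X * fps_deriv A = of_nat p * fps_X ^ p"
    using p by (intro fps_ext) (simp add: A_def fps_X_deriv_nth fps_mult_of_nat_nth del: fps_deriv_add)
  hence lam: "lambda_op m f g = (if m = 0 \<or> m = p then 1 else 0)" for m
    using lambda_op_eqI[of A f g m] p P by (simp add: P_def A_def)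
  show "lambda_op n f g = (if n = 0 \<or> n = p then 1 else 0)" by (rule lam)
  have "Abs_fps (\<lambda>i. (- 1) ^ i * lambda_op i f g) = 1 - fps_X ^ p"
    using p \<open>odd p\<close> by (auto simp: lam fps_eq_iff)
  moreover have "inverse (1 - fps_X ^ p) = Abs_fps (\<lambda>i. if p dvd i then 1 else (0::complex))"
  proof (rule fps_inverse_unique, rule fps_ext)
    fix m
    show "fps_nth ((1 - fps_X ^ p) * Abs_fps (\<lambda>i. if p dvd i then 1 else (0::complex))) m
        = fps_nth 1 m"
      using p by (auto simp: left_diff_distrib fps_X_power_mult_nth dvd_minus_self dest: dvd_imp_le)
  qed
  ultimately show "sym_op n f g = (if p dvd n then 1 else 0)"
    by (simp add: sym_op_eq)
qed

section \<open>Powers in the Heisenberg group and exponents modulo \<open>p\<close>\<close>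

lemma M_power:
  "M a b c ^ n = M (of_nat n * a) (of_nat n * b + of_nat (n choose 2) * (a * c)) (of_nat n * c)"
proof (induction n)
  case (Suc n)
  \<comment> \<open>Passing from \<open>n\<close> to \<open>Suc n\<close> adds \<open>n a c\<close>
    to the corner entry, and 0 + 1 + ... + (n - 1) is \<open>n choose 2\<close>.\<close>
  thus ?case by (simp add: times_M algebra_simps numeral_2_eq_2)
qed (simp add: one_M numeral_2_eq_2)

text \<open>The sort \<open>nontriv\<close> does not make the ring a field, so primality is applied
  to a natural representative of \<open>a\<close>, which is positive and below
  \<open>p\<close>.\<close>

lemma of_nat_times_mod_ring_eq_0_iff:
  fixes a :: "'p::nontriv mod_ring"
  assumes "prime CARD('p)" "a \<noteq> 0"
  shows "of_nat k * a = 0 \<longleftrightarrow> CARD('p) dvd k"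
proof -
  define m where "m = nat (to_int_mod_ring a)"
  have "to_int_mod_ring a \<in> {0..<int CARD('p)}"
    using range_to_int_mod_ring[where 'a = 'p] by blast
  hence a: "a = of_nat m" and m: "m < CARD('p)"
    by (auto simp: m_def of_nat_of_int_mod_ring)
  hence "\<not> CARD('p) dvd m" using assms(2) by (auto dest: dvd_imp_le)
  moreover have "of_nat k * a = 0 \<longleftrightarrow> CARD('p) dvd k * m"
    unfolding a by (simp only: of_nat_eq_0_iff_char_dvd semiring_char_mod_ring flip: of_nat_mult)
  ultimately show ?thesis using assms(1) by (simp add: prime_dvd_mult_iff)
qed

text \<open>Representatives are multiplicative only up to multiples of \<open>p\<close>, and these
  do not affect powers of a \<open>p\<close>-th root of unity.\<close>

lemma power_to_int_mod_ring_of_nat_mult: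
  fixes b :: "'p::nontriv mod_ring" and w :: complex
  assumes "w ^ CARD('p) = 1"
  shows "w ^ nat (to_int_mod_ring (of_nat k * b)) = w ^ (k * nat (to_int_mod_ring b))"
proof -
  define m where "m = nat (to_int_mod_ring b)"
  have "to_int_mod_ring b \<in> {0..<int CARD('p)}"
    using range_to_int_mod_ring[where 'a = 'p] by blast
  hence b: "b = of_nat m" by (auto simp: m_def of_nat_of_int_mod_ring)
  have w_mod: "w ^ (k * m mod CARD('p)) = w ^ (k * m)"
  proof -
    have "w ^ (k * m) = w ^ (k * m mod CARD('p) + CARD('p) * (k * m div CARD('p)))"
      by (simp only: mod_mult_div_eq)
    thus ?thesis by (simp only: power_add power_mult assms power_one mult_1_right)
  qed
  have "to_int_mod_ring (of_nat k * b) = int (k * m mod CARD('p))"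
    unfolding b of_nat_mult[symmetric] by transfer (simp add: zmod_int)
  hence "nat (to_int_mod_ring (of_nat k * b)) = k * m mod CARD('p)" by (simp only: nat_int)
  thus ?thesis by (simp only: w_mod flip: m_def)
qed

section \<open>Character values and the vanishing sum of the linear characters\<close>

lemma to_int_mod_ring_nonneg: "0 \<le> to_int_mod_ring (a :: 'p::finite mod_ring)"
  using range_to_int_mod_ring[where 'a = 'p] by (metis atLeastLessThan_iff rangeI)

lemma tau_M_nat: "tau \<eta> s (M a b c :: 'p::nontriv heisenberg) =
    (if a = 0 \<and> c = 0 then of_nat CARD('p) * (\<eta> ^ s) ^ nat (to_int_mod_ring b) else 0)"
proof -
  have "\<eta> powi (int s * to_int_mod_ring b) = (\<eta> ^ s) ^ nat (to_int_mod_ring b)"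
    using to_int_mod_ring_nonneg[of b]
    by (simp add: power_int_def nat_mult_distrib power_mult)
  thus ?thesis by (simp add: tau_M)
qed

lemma chi_M_nat: "chi \<eta> i j (M a b c) =
    (\<eta> ^ nat (to_int_mod_ring a)) ^ i * (\<eta> ^ nat (to_int_mod_ring c)) ^ j"
  using to_int_mod_ring_nonneg[of a] to_int_mod_ring_nonneg[of c]
  by (simp add: chi_M power_int_def nat_add_distrib nat_mult_distrib power_add power_mult)

lemma sum_root_of_unity_powers:
  fixes z :: "'a::field"
  assumes "z ^ p = 1" "z \<noteq> 1"
  shows "(\<Sum>i<p. z ^ i) = 0"
  using assms by (simp add: geometric_sum)

text \<open>The double sum factors into two geometric sums. A nonzero coordinate has its
  representative strictly between 0 and \<open>p\<close>, so by primitivity the ratio of its sum is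
  not 1 and that sum vanishes.\<close>

lemma sum_chi:
  assumes "primitive_root_of_unity CARD('p::nontriv) \<eta>" "a \<noteq> 0 \<or> c \<noteq> 0"
  shows "(\<Sum>(i, j) \<in> {..<CARD('p)} \<times> {..<CARD('p)}. chi \<eta> i j (M a b c :: 'p heisenberg)) = 0"
proof -
  let ?z = "\<lambda>x :: 'p mod_ring. \<eta> ^ nat (to_int_mod_ring x)"
  have "?z x ^ CARD('p) = 1" for x
    using assms(1) by (simp add: primitive_root_of_unity_def mult.commute flip: power_mult)
      (simp add: power_mult)
  moreover have "?z x \<noteq> 1" if "x \<noteq> 0" for x
  proof -
    have "to_int_mod_ring x \<in> {0..<int CARD('p)}"
      using range_to_int_mod_ring[where 'a = 'p] by blast
    moreover have "to_int_mod_ring x \<noteq> 0" using that by simp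
    ultimately have "0 < nat (to_int_mod_ring x)" "nat (to_int_mod_ring x) < CARD('p)"
      unfolding atLeastLessThan_iff by linarith+
    thus ?thesis using assms(1) by (simp add: primitive_root_of_unity_def)
  qed
  ultimately have "(\<Sum>i<CARD('p). ?z a ^ i) = 0 \<or> (\<Sum>j<CARD('p). ?z c ^ j) = 0"
    using assms(2) by (meson sum_root_of_unity_powers)
  moreover have "(\<Sum>(i, j) \<in> {..<CARD('p)} \<times> {..<CARD('p)}. chi \<eta> i j (M a b c :: 'p heisenberg))
      = (\<Sum>i<CARD('p). ?z a ^ i) * (\<Sum>j<CARD('p). ?z c ^ j)"
    by (simp add: chi_M_nat sum_product sum.cartesian_product)
  ultimately show ?thesis by auto
qed

section \<open>Comparison of both sides at each group element\<close>

lemma cscale_apply: "(c *\<^sub>C f) g = c * f g"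
  by (simp add: cscale_def)

lemma sum_fun_apply: "(\<Sum>k\<in>S. h k) x = (\<Sum>k\<in>S. h k x)"
  for h :: "'b \<Rightarrow> 'a \<Rightarrow> 'c::comm_monoid_add"
  by (induction S rule: infinite_finite_induct) simp_all

theorem mainTheorem6:
  fixes p s n n' :: nat and \<eta> :: complex
  assumes "p = CARD('p::nontriv)" and "prime p" and "p \<noteq> 2"
    and "primitive_root_of_unity p \<eta>"
    and "s \<in> {1..p - 1}"
    and "\<not> p dvd n \<Longrightarrow> n' \<in> {1..p - 1} \<and> [n * s = n'] (mod p)"
  shows
    "lambda_op n (tau \<eta> s :: 'p heisenberg \<Rightarrow> complex) =
       (if n = 0 \<or> n = p then chi \<eta> 0 0
        else if n < p then (1 / of_nat p * of_nat (p choose n)) *\<^sub>C tau \<eta> n'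
        else 0)
     \<and>
     sym_op n (tau \<eta> s :: 'p heisenberg \<Rightarrow> complex) =
       (if p dvd n then
          (1 / of_nat p ^ 2 * (of_nat ((p + n - 1) choose n) + (of_nat p ^ 2 - 1))) *\<^sub>C chi \<eta> 0 0
          + (\<Sum>(i, j) \<in> {0..p - 1} \<times> {0..p - 1} - {(0, 0)}.
               (1 / of_nat p ^ 2 * (of_nat ((p + n - 1) choose n) - 1)) *\<^sub>C chi \<eta> i j)
        else (1 / of_nat p * of_nat ((p + n - 1) choose n)) *\<^sub>C tau \<eta> n')"
    (is "lambda_op n ?t = ?L \<and> sym_op n ?t = ?S")
proof -
  have p: "p > 0" "odd p"
    using assms(2,3) prime_gt_0_nat prime_odd_nat[of p] prime_ge_2_nat[of p] by auto
  have \<eta>p: "\<eta> ^ p = 1" using assms(4) by (simp add: primitive_root_of_unity_def)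
  have "lambda_op n ?t g = ?L g \<and> sym_op n ?t g = ?S g" for g
  proof (cases g)
    case (1 a b c)
    have chi0: "chi \<eta> 0 0 g = 1" by (simp add: 1 chi_M)
    define N :: complex where "N = of_nat ((p + n - 1) choose n)"
    define D where "D = (\<Sum>(i, j) \<in> {0..p - 1} \<times> {0..p - 1} - {(0, 0)}. chi \<eta> i j g)"
    have D: "D = (\<Sum>(i, j) \<in> {..<p} \<times> {..<p}. chi \<eta> i j g) - 1"
    proof -
      have "{0..p - 1} = {..<p}" using p(1) by auto
      thus ?thesis using p(1) by (simp add: D_def sum_diff1 chi0)
    qed
    \<comment> \<open>All nontrivial linear characters have the same coefficient, so they enter only
      through their sum \<open>D\<close>.\<close>
    have S_dvd: "?S g = 1 / of_nat p ^ 2 * (N + (of_nat p ^ 2 - 1))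
        + 1 / of_nat p ^ 2 * (N - 1) * D" if "p dvd n"
      using that by (simp add: cscale_apply chi0 sum_fun_apply D_def N_def sum_distrib_left
        case_prod_beta)
    show ?thesis
    proof (cases "a = 0 \<and> c = 0")
      case True
      define w where "w = (\<eta> ^ s) ^ nat (to_int_mod_ring b)"
      have wp: "w ^ p = 1"
        using \<eta>p by (metis (no_types, lifting) w_def power_mult mult.commute power_one)
      have pow: "?t (g ^ k) = of_nat p * w ^ k" for k
      proof -
        have "(\<eta> ^ s) ^ p = 1" by (metis \<eta>p mult.commute power_mult power_one)
        hence "(\<eta> ^ s) ^ nat (to_int_mod_ring (of_nat k * b)) = w ^ k"
          using power_to_int_mod_ring_of_nat_mult[of "\<eta> ^ s" k b]
          by (metis assms(1) mult.commute power_mult w_def)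
        thus ?thesis using True by (simp add: 1 M_power tau_M_nat assms(1))
      qed
      have w_dvd: "w ^ n = 1" if "p dvd n"
        using that wp by (auto simp: power_mult elim!: dvdE)
      \<comment> \<open>As \<open>n'\<close> is congruent to \<open>n s\<close> modulo
        \<open>p\<close>, the two exponents give the same power of \<open>\<eta>\<close>.\<close>
      have tau': "tau \<eta> n' g = of_nat p * w ^ n" if "\<not> p dvd n"
      proof -
        from assms(6)[OF that] have "n * s mod p = n' mod p" by (simp add: cong_def)
        moreover have "\<eta> ^ k = \<eta> ^ (k mod p)" for k
        proof -
          have "\<eta> ^ k = \<eta> ^ (p * (k div p) + k mod p)" by simp
          also have "\<dots> = \<eta> ^ (k mod p)" by (simp only: power_add power_mult \<eta>p) simp
          finally show ?thesis .
        qed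
        ultimately have "\<eta> ^ n' = \<eta> ^ (n * s)" by metis
        hence "(\<eta> ^ n') ^ nat (to_int_mod_ring b) = w ^ n"
          by (simp add: w_def mult_ac flip: power_mult)
        thus ?thesis using True by (simp add: 1 tau_M_nat assms(1))
      qed
      \<comment> \<open>Linear characters are 1 on the centre. Substituting,
        \<open>N + (p^2 - 1) + (N - 1) (p^2 - 1)\<close> equals \<open>p^2 N\<close>.\<close>
      have "D = of_nat p ^ 2 - 1"
        using True by (simp add: D 1 chi_M_nat power2_eq_square case_prod_beta)
      hence "?S g = N" if "p dvd n"
        unfolding S_dvd[OF that] using p(1) by (simp only:) (simp add: field_simps)
      moreover have "?S g = N * w ^ n" if "\<not> p dvd n"
        using that p(1) by (simp add: cscale_apply tau' N_def)
      ultimately have "?S g = N * w ^ n" using w_dvd by (cases "p dvd n") auto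
      moreover have "?L g = of_nat (p choose n) * w ^ n"
      proof -
        consider "n = 0 \<or> n = p" | "n \<noteq> 0" "n < p" | "p < n" by linarith
        thus ?thesis
        proof cases
          case 1
          thus ?thesis using chi0 wp by auto
        next
          case 2
          hence "\<not> p dvd n" by (auto dest: dvd_imp_le)
          thus ?thesis using 2 tau' p(1) by (simp add: cscale_apply)
        next
          case 3
          thus ?thesis by (simp add: binomial_eq_0)
        qed
      qed
      ultimately show ?thesis
        using lambda_op_scalar[OF p(1) pow, of n] sym_op_scalar[OF p(1) pow, of n]
        by (simp only: N_def)
    next
      case False
      \<comment> \<open>The powers of \<open>g\<close> with \<open>p dvd k\<close> are trivial. For
        the others \<open>k a\<close> or \<open>k c\<close> is nonzero, so the power is noncentral
        and \<open>?t\<close> vanishes there.\<close>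
      have "?t (g ^ k) = (if p dvd k then of_nat p else 0)" if "k > 0" for k
      proof (cases "p dvd k")
        case True
        \<comment> \<open>This makes the corner entry of \<open>g ^ k\<close> vanish. Oddness of
          \<open>p\<close> is what allows the factor 2 to be removed.\<close>
        have choose2: "p dvd (k choose 2)"
        proof -
          have "2 * (k choose 2) = k * (k - 1)"
            by (metis choose_two dvd_mult_div_cancel even_mult_iff odd_even_add even_diff_nat
                odd_one)
          hence "p dvd 2 * (k choose 2)" using True by simp
          moreover have "coprime p 2" using p(2) by simp
          ultimately show ?thesis by (simp add: coprime_dvd_mult_right_iff)
        qed
        have "of_nat m = (0 :: 'p mod_ring)" if "p dvd m" for m
          using that by (simp add: of_nat_eq_0_iff_char_dvd assms(1))
        hence "g ^ k = M 0 0 0" using True choose2 by (simp add: 1 M_power)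
        thus ?thesis using True by (simp add: tau_M assms(1))
      next
        case ndvd: False
        hence "of_nat k * x \<noteq> 0" if "x \<noteq> 0" for x :: "'p mod_ring"
          using of_nat_times_mod_ring_eq_0_iff[OF _ that] assms(1,2) by simp
        thus ?thesis using ndvd False by (auto simp: 1 M_power tau_M)
      qed
      hence ops: "lambda_op n ?t g = (if n = 0 \<or> n = p then 1 else 0)"
        "sym_op n ?t g = (if p dvd n then 1 else 0)"
        using lambda_op_regular[OF p(2)] sym_op_regular[OF p(2)] by blast+
      have tau': "tau \<eta> m g = 0" for m using False by (auto simp: 1 tau_M)
      \<comment> \<open>The full character sum vanishes off the centre, and the trivial character
        contributes 1 to it. The two terms with \<open>N\<close> then cancel in
        \<open>S_dvd\<close>.\<close>
      have "D = - 1"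
        using sum_chi[of \<eta> a c b] False assms(1,4) by (simp add: D 1)
      hence "?S g = 1" if "p dvd n"
        unfolding S_dvd[OF that] using p(1) by (simp add: field_simps)
      moreover have "?S g = 0" if "\<not> p dvd n"
        using that by (simp add: cscale_apply tau')
      moreover have "?L g = (if n = 0 \<or> n = p then 1 else 0)"
        by (simp add: chi0 cscale_apply tau')
      ultimately show ?thesis using ops by (cases "p dvd n") auto
    qed
  qed
  thus ?thesis by (simp only: fun_eq_iff simp_thms)
qed

end
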